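(* For arbitrary probability measures $Q_1,Q_2,Q_3$ on $\mathbb{R}$: (reflexivity) $Q_1\le_{\rm lr}Q_1$; (antisymmetry) $Q_1\le_{\rm lr}Q_2$ and $Q_2\le_{\rm lr}Q_1$ implies that $Q_1=Q_2$; (transitivity) $Q_1\le_{\rm lr}Q_2$ and $Q_2\le_{\rm lr}Q_3$ implies that $Q_1\le_{\rm lr}Q_3$.
   Context: Likelihood ratio order: for probability measures $Q_1,Q_2$ on $\mathbb{R}$ (with Borel $\sigma$-field), $Q_1\le_{\rm lr}Q_2$ means that there exist a $\sigma$-finite measure $\mu$ and densities $g_j=\mathrm{d}Q_j/\mathrm{d}\mu:\mathbb{R}\to[0,\infty)$ ($j=1,2$) such that $g_2/g_1$ (with values in $[0,\infty]$, $c/0:=\infty$ for $c>0$) is non-decreasing on $\{g_1+g_2>0\}$. *)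

theory Defs
  imports "HOL-Probability.Probability"
begin

(* The densities are finite and nonnegative, and their ratio is formed in ennreal, where
   c / 0 = top for c > 0.  The library value 0 / 0 = 0 is irrelevant, since the ratio is only
   considered where g1 + g2 > 0. *)
definition lr_le :: "real measure \<Rightarrow> real measure \<Rightarrow> bool" (infix "\<le>\<^sub>l\<^sub>r" 50) where
  "Q1 \<le>\<^sub>l\<^sub>r Q2 \<longleftrightarrow>
    (\<exists>(\<mu> :: real measure) (g1 :: real \<Rightarrow> real) (g2 :: real \<Rightarrow> real).
       sets \<mu> = sets borel \<and> sigma_finite_measure \<mu> \<and>
       g1 \<in> borel_measurable borel \<and> g2 \<in> borel_measurable borel \<and>
       (\<forall>x. 0 \<le> g1 x) \<and> (\<forall>x. 0 \<le> g2 x) \<and>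
       Q1 = density \<mu> (\<lambda>x. ennreal (g1 x)) \<and>
       Q2 = density \<mu> (\<lambda>x. ennreal (g2 x)) \<and>
       mono_on {x. g1 x + g2 x > 0} (\<lambda>x. ennreal (g2 x) / ennreal (g1 x)))"

end

theory Submission
  imports Defs
begin

text \<open>
  Cross-multiplying, the ratio $g_2/g_1$ is non-decreasing on $\{g_1+g_2>0\}$ if and only if
  $g_2(x)\,g_1(y) \le g_2(y)\,g_1(x)$ for all $x<y$.  Integrating this over $x \in A$, $y \in B$
  with $A = (-\infty,t]$ and $B = (t,\infty)$ gives the stochastic order of the distribution
  functions, hence antisymmetry.  For transitivity, take densities $r_1,r_2,r_3$ with respect to
  one finite measure dominating $Q_1,Q_2,Q_3$.  Almost everywhere, $(r_1,r_2)$ is proportional to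
  the densities witnessing $Q_1 \le Q_2$, and likewise for $(r_2,r_3)$; after setting all $r_i$ to
  zero on the exceptional null set, the cross-multiplied inequalities hold everywhere.  They
  compose because $r_2$ does not vanish identically.
\<close>

section \<open>Cross-multiplied form of the likelihood ratio order\<close>

lemma ennreal_ratio_le_iff:
  fixes a b c d :: real
  assumes "0 \<le> a" "0 \<le> b" "0 \<le> c" "0 \<le> d" "a + b > 0" "c + d > 0"
  shows "ennreal b / ennreal a \<le> ennreal d / ennreal c \<longleftrightarrow> b * c \<le> d * a"
  using assms
  \<comment> \<open>If \<open>a = 0\<close> then \<open>b > 0\<close>, the left ratio is
    \<open>top\<close>, and \<open>b * c \<le> 0\<close> says exactly that \<open>c = 0\<close>, so
    that the right ratio is \<open>top\<close> too. If \<open>c = 0\<close>, the right ratio is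
    \<open>top\<close> and \<open>b * c = 0\<close>.\<close>
  by (cases "a = 0"; cases "c = 0")
     (simp_all add: divide_ennreal top_unique mult_le_0_iff not_le field_simps)

text \<open>Outside \<open>{x. g1 x + g2 x > 0}\<close> both functions vanish, which makes the
  product inequality trivial as soon as one of the two points lies there. This removes the domain
  restriction and the division from the definition.\<close>

lemma mono_on_ratio_iff:
  fixes g1 g2 :: "'a::linorder \<Rightarrow> real"
  assumes "\<forall>x. 0 \<le> g1 x" "\<forall>x. 0 \<le> g2 x"
  shows "mono_on {x. g1 x + g2 x > 0} (\<lambda>x. ennreal (g2 x) / ennreal (g1 x)) \<longleftrightarrow>
    (\<forall>x y. x < y \<longrightarrow> g2 x * g1 y \<le> g2 y * g1 x)"
proof
  assume m: "mono_on {x. g1 x + g2 x > 0} (\<lambda>x. ennreal (g2 x) / ennreal (g1 x))"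
  show "\<forall>x y. x < y \<longrightarrow> g2 x * g1 y \<le> g2 y * g1 x"
  proof (intro allI impI)
    fix x y :: 'a assume "x < y"
    show "g2 x * g1 y \<le> g2 y * g1 x"
    proof (cases "g1 x + g2 x > 0 \<and> g1 y + g2 y > 0")
      case True
      with mono_onD[OF m, of x y] \<open>x < y\<close> assms show ?thesis
        by (simp add: ennreal_ratio_le_iff)
    next
      case False
      then have "g2 x = 0 \<and> g1 x = 0 \<or> g2 y = 0 \<and> g1 y = 0"
        using assms by (smt (verit))
      then show ?thesis by auto
    qed
  qed
next
  assume c: "\<forall>x y. x < y \<longrightarrow> g2 x * g1 y \<le> g2 y * g1 x"
  show "mono_on {x. g1 x + g2 x > 0} (\<lambda>x. ennreal (g2 x) / ennreal (g1 x))"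
  proof (rule mono_onI)
    fix x y :: 'a
    assume "x \<in> {x. g1 x + g2 x > 0}" "y \<in> {x. g1 x + g2 x > 0}" "x \<le> y"
    then show "ennreal (g2 x) / ennreal (g1 x) \<le> ennreal (g2 y) / ennreal (g1 y)"
      using c assms by (cases "x = y") (auto simp: ennreal_ratio_le_iff)
  qed
qed

lemma lr_le_iff:
  "Q1 \<le>\<^sub>l\<^sub>r Q2 \<longleftrightarrow>
    (\<exists>(\<mu> :: real measure) (g1 :: real \<Rightarrow> real) (g2 :: real \<Rightarrow> real).
       sets \<mu> = sets borel \<and> sigma_finite_measure \<mu> \<and>
       g1 \<in> borel_measurable borel \<and> g2 \<in> borel_measurable borel \<and>
       (\<forall>x. 0 \<le> g1 x) \<and> (\<forall>x. 0 \<le> g2 x) \<and>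
       Q1 = density \<mu> (\<lambda>x. ennreal (g1 x)) \<and>
       Q2 = density \<mu> (\<lambda>x. ennreal (g2 x)) \<and>
       (\<forall>x y. x < y \<longrightarrow> g2 x * g1 y \<le> g2 y * g1 x))"
  unfolding lr_le_def by (simp add: mono_on_ratio_iff cong: conj_cong)

section \<open>Reflexivity\<close>

lemma lr_le_refl:
  assumes "real_distribution Q"
  shows "Q \<le>\<^sub>l\<^sub>r Q"
proof -
  interpret real_distribution Q by fact
  \<comment> \<open>\<open>Q\<close> itself serves as dominating measure, with both densities
    constantly 1.\<close>
  have "Q = density Q (\<lambda>x. ennreal 1)"
    by (simp add: density_1)
  then show ?thesis
    unfolding lr_le_iff
    by (intro exI[of _ Q] exI[of _ "\<lambda>_. 1"]) (auto intro: sigma_finite_measure_axioms)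
qed

section \<open>Distribution functions and antisymmetry\<close>

lemma emeasure_mult_le_of_density:
  fixes g1 g2 :: "'a \<Rightarrow> real"
  assumes [measurable]: "g1 \<in> borel_measurable \<mu>" "g2 \<in> borel_measurable \<mu>"
      "A \<in> sets \<mu>" "B \<in> sets \<mu>"
    and nonneg: "\<And>x. 0 \<le> g1 x" "\<And>x. 0 \<le> g2 x"
    and le: "\<And>x y. x \<in> A \<Longrightarrow> y \<in> B \<Longrightarrow> g2 x * g1 y \<le> g2 y * g1 x"
  shows "emeasure (density \<mu> g2) A * emeasure (density \<mu> g1) B
    \<le> emeasure (density \<mu> g2) B * emeasure (density \<mu> g1) A"
proof -
  \<comment> \<open>The integrand is a function of \<open>x\<close> times a function of
    \<open>y\<close>, so the iterated integral factors by pulling out constants.\<close>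
  have "emeasure (density \<mu> g2) A * emeasure (density \<mu> g1) B
    = (\<integral>\<^sup>+x. (\<integral>\<^sup>+y. ennreal (g2 x) * indicator A x * (ennreal (g1 y) * indicator B y) \<partial>\<mu>) \<partial>\<mu>)"
    by (simp add: emeasure_density nn_integral_cmult nn_integral_multc)
  also have "\<dots> \<le> (\<integral>\<^sup>+x. (\<integral>\<^sup>+y. ennreal (g1 x) * indicator A x * (ennreal (g2 y) * indicator B y) \<partial>\<mu>) \<partial>\<mu>)"
    using le nonneg
    by (intro nn_integral_mono)
       (auto split: split_indicator simp: ennreal_mult[symmetric] mult.commute intro!: ennreal_leI)
  also have "\<dots> = emeasure (density \<mu> g2) B * emeasure (density \<mu> g1) A"
    by (simp add: emeasure_density nn_integral_cmult nn_integral_multc mult.commute)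
  finally show ?thesis .
qed

text \<open>With \<open>A = {..t}\<close>, \<open>B = {t<..}\<close> and distribution functions F1,
  F2, the integrated inequality reads F2 (1 - F1) \<le> (1 - F2) F1 at \<open>t\<close>; the product
  F1 F2 cancels.\<close>

lemma lr_le_imp_cdf_le:
  assumes "real_distribution Q1" "real_distribution Q2" "Q1 \<le>\<^sub>l\<^sub>r Q2"
  shows "cdf Q2 t \<le> cdf Q1 t"
proof -
  interpret Q1: real_distribution Q1 by fact
  interpret Q2: real_distribution Q2 by fact
  obtain \<mu> :: "real measure" and g1 g2 :: "real \<Rightarrow> real" where
    sets: "sets \<mu> = sets borel"
    and meas: "g1 \<in> borel_measurable borel" "g2 \<in> borel_measurable borel"
    and nonneg: "\<forall>x. 0 \<le> g1 x" "\<forall>x. 0 \<le> g2 x"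
    and Q: "Q1 = density \<mu> (\<lambda>x. ennreal (g1 x))" "Q2 = density \<mu> (\<lambda>x. ennreal (g2 x))"
    and le: "\<forall>x y. x < y \<longrightarrow> g2 x * g1 y \<le> g2 y * g1 x"
    using assms(3) unfolding lr_le_iff by blast
  have "emeasure Q2 {..t} * emeasure Q1 {t<..} \<le> emeasure Q2 {t<..} * emeasure Q1 {..t}"
    unfolding Q using meas nonneg le
    by (intro emeasure_mult_le_of_density)
       (auto simp: sets measurable_cong_sets[OF sets refl])
  then have "measure Q2 {..t} * measure Q1 {t<..} \<le> measure Q2 {t<..} * measure Q1 {..t}"
    by (simp add: Q1.emeasure_eq_measure Q2.emeasure_eq_measure ennreal_mult[symmetric])
  moreover have "measure Q1 {t<..} = 1 - measure Q1 {..t}"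
    using Q1.prob_compl[of "{..t}"] by (simp add: Compl_eq_Diff_UNIV[symmetric])
  moreover have "measure Q2 {t<..} = 1 - measure Q2 {..t}"
    using Q2.prob_compl[of "{..t}"] by (simp add: Compl_eq_Diff_UNIV[symmetric])
  ultimately show ?thesis
    by (simp add: cdf_def algebra_simps)
qed

lemma lr_le_antisym:
  assumes "real_distribution Q1" "real_distribution Q2" "Q1 \<le>\<^sub>l\<^sub>r Q2" "Q2 \<le>\<^sub>l\<^sub>r Q1"
  shows "Q1 = Q2"
  using assms by (intro cdf_unique ext antisym lr_le_imp_cdf_le)

section \<open>A common dominating measure and finite densities\<close>

lemma ex_finite_measure_dominating:
  assumes "finite_measure M" "finite_measure N" "sets N = sets M"
  shows "\<exists>L. finite_measure L \<and> sets L = sets M \<and>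
    absolutely_continuous L M \<and> absolutely_continuous L N"
proof -
  interpret M: finite_measure M by fact
  interpret N: finite_measure N by fact
  \<comment> \<open>The sum of the two measures: a null set of the sum is null for each
    summand.\<close>
  define L where "L = measure_of (space M) (sets M) (\<lambda>A. emeasure M A + emeasure N A)"
  have sets: "sets L = sets M"
    unfolding L_def by simp
  have em: "emeasure L A = emeasure M A + emeasure N A" if "A \<in> sets M" for A
  proof (rule emeasure_measure_of[OF L_def])
    show "sets M \<subseteq> Pow (space M)"
      by (rule sets.space_closed)
    show "positive (sets L) (\<lambda>A. emeasure M A + emeasure N A)"
      by (simp add: positive_def)
    show "countably_additive (sets L) (\<lambda>A. emeasure M A + emeasure N A)"
      unfolding sets
    proof (rule countably_additiveI)
      fix A :: "nat \<Rightarrow> _"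
      assume "range A \<subseteq> sets M" "disjoint_family A"
      then show "(\<Sum>i. emeasure M (A i) + emeasure N (A i))
          = emeasure M (\<Union>i. A i) + emeasure N (\<Union>i. A i)"
        by (simp add: suminf_add[symmetric] suminf_emeasure assms(3))
    qed
    show "A \<in> sets L"
      using that sets by simp
  qed
  have "finite_measure L"
    by (rule finite_measureI) (simp add: em sets sets_eq_imp_space_eq[OF sets])
  then show ?thesis
    using sets em assms(3)
    by (intro exI[of _ L]) (auto simp: absolutely_continuous_def null_sets_def)
qed

text \<open>A Radon-Nikodym derivative may take the value infinity, but sigma-finiteness of
  \<open>N\<close> confines this to a null set, where \<open>enn2real\<close> replaces it by
  0.\<close>

lemma (in sigma_finite_measure) ex_real_density:
  assumes "absolutely_continuous M N" "sets N = sets M" "sigma_finite_measure N"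
  obtains r :: "'a \<Rightarrow> real" where "r \<in> borel_measurable M" "\<And>x. 0 \<le> r x" "N = density M r"
proof -
  obtain f where f [measurable]: "f \<in> borel_measurable M" and N: "density M f = N"
    using Radon_Nikodym[OF assms(1,2)] by blast
  have "AE x in M. f x \<noteq> \<infinity>"
    using sigma_finite_iff_density_finite[OF f] assms(3) N by simp
  then have "AE x in M. f x = ennreal (enn2real (f x))"
    by eventually_elim (simp add: less_top)
  then have "N = density M (\<lambda>x. ennreal (enn2real (f x)))"
    unfolding N[symmetric] by (intro density_cong) auto
  then show ?thesis
    by (intro that[of "\<lambda>x. enn2real (f x)"]) auto
qed

section \<open>Passing to other densities and another dominating measure\<close>

lemma AE_density_pos_imp_pos:
  assumes eq: "density L r = density M g"
    and [measurable]: "r \<in> borel_measurable L" "g \<in> borel_measurable M"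
  shows "AE x in L. 0 < r x \<longrightarrow> 0 < g x"
proof -
  \<comment> \<open>The zero set of \<open>g\<close> is null for the measure with density
    \<open>g\<close>; read through the density \<open>r\<close>, this is a statement about
    \<open>L\<close>.\<close>
  have "AE x in density M g. 0 < g x"
    by (simp add: AE_density)
  then show ?thesis
    unfolding eq[symmetric] by (simp add: AE_density)
qed

lemma lr_le_AE_cross_le:
  assumes "Q1 \<le>\<^sub>l\<^sub>r Q2" and L: "sigma_finite_measure L" "sets L = sets borel"
    and r [measurable]: "r1 \<in> borel_measurable borel" "r2 \<in> borel_measurable borel"
    and r_nonneg: "\<And>x. 0 \<le> r1 x" "\<And>x. 0 \<le> r2 x"
    and Qr: "Q1 = density L (\<lambda>x. ennreal (r1 x))" "Q2 = density L (\<lambda>x. ennreal (r2 x))"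
  shows "\<exists>P. (AE x in L. P x) \<and>
    (\<forall>x y. P x \<longrightarrow> P y \<longrightarrow> x < y \<longrightarrow> r2 x * r1 y \<le> r2 y * r1 x)"
proof -
  interpret L: sigma_finite_measure L by fact
  obtain \<mu> :: "real measure" and f1 f2 :: "real \<Rightarrow> real" where
    sets [measurable_cong]: "sets \<mu> = sets borel"
    and f [measurable]: "f1 \<in> borel_measurable borel" "f2 \<in> borel_measurable borel"
    and nonneg: "\<And>x. 0 \<le> f1 x" "\<And>x. 0 \<le> f2 x"
    and Qf: "Q1 = density \<mu> (\<lambda>x. ennreal (f1 x))" "Q2 = density \<mu> (\<lambda>x. ennreal (f2 x))"
    and le: "\<And>x y. x < y \<Longrightarrow> f2 x * f1 y \<le> f2 y * f1 x"
    using assms(1) unfolding lr_le_iff by blast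
  note [measurable_cong] = L(2)
  \<comment> \<open>At such points (r1, r2) is a multiple of (f1, f2). The positivity clauses
    exclude that both \<open>f1\<close> and \<open>f2\<close> vanish where \<open>r1\<close> or
    \<open>r2\<close> does not, in which case the product identity would carry no
    information.\<close>
  define P where
    "P x \<longleftrightarrow> (0 < r1 x \<longrightarrow> 0 < f1 x) \<and> (0 < r2 x \<longrightarrow> 0 < f2 x) \<and> r1 x * f2 x = r2 x * f1 x" for x
  have pos1: "AE x in L. 0 < ennreal (r1 x) \<longrightarrow> 0 < ennreal (f1 x)"
    using Qr(1) Qf(1) by (intro AE_density_pos_imp_pos[of L _ \<mu>]) auto
  have pos2: "AE x in L. 0 < ennreal (r2 x) \<longrightarrow> 0 < ennreal (f2 x)"
    using Qr(2) Qf(2) by (intro AE_density_pos_imp_pos[of L _ \<mu>]) auto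
  \<comment> \<open>Both products are densities of the same measure: \<open>f2\<close> times
    \<open>Q1\<close> and \<open>f1\<close> times \<open>Q2\<close> each have density
    \<open>f1 * f2\<close> with respect to \<open>\<mu>\<close>.\<close>
  have "density L (\<lambda>x. ennreal (r1 x) * ennreal (f2 x)) = density Q1 (\<lambda>x. ennreal (f2 x))"
    unfolding Qr(1) by (simp add: density_density_eq)
  also have "\<dots> = density Q2 (\<lambda>x. ennreal (f1 x))"
    unfolding Qf by (simp add: density_density_eq mult.commute)
  also have "\<dots> = density L (\<lambda>x. ennreal (r2 x) * ennreal (f1 x))"
    unfolding Qr(2) by (simp add: density_density_eq)
  finally have "AE x in L. ennreal (r1 x) * ennreal (f2 x) = ennreal (r2 x) * ennreal (f1 x)"
    by (intro L.density_unique) auto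
  with pos1 pos2 have "AE x in L. P x"
    by eventually_elim (simp add: P_def r_nonneg nonneg ennreal_mult[symmetric])
  moreover have "r2 x * r1 y \<le> r2 y * r1 x" if P: "P x" "P y" and "x < y" for x y
  proof (cases "r2 x = 0 \<or> r1 y = 0")
    case True
    then show ?thesis using r_nonneg[of x] r_nonneg[of y] by auto
  next
    case False
    then have "0 < r2 x" "0 < r1 y"
      using r_nonneg(2)[of x] r_nonneg(1)[of y] by auto
    with P have f_pos: "0 < f2 x" "0 < f1 y" by (auto simp: P_def)
    then have "0 < f2 y * f1 x"
      using le[OF \<open>x < y\<close>] by (smt (verit) mult_pos_pos)
    \<comment> \<open>Multiply the identities \<open>r2 x * f1 x = r1 x * f2 x\<close> and
      \<open>r1 y * f2 y = r2 y * f1 y\<close>. The positive factor \<open>f2 y * f1 x\<close> is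
      cancelled at the end.\<close>
    moreover have "(r2 x * r1 y) * (f2 y * f1 x) = (r2 y * r1 x) * (f2 x * f1 y)"
      using P by (simp add: P_def) algebra
    moreover have "\<dots> \<le> (r2 y * r1 x) * (f2 y * f1 x)"
      using le[OF \<open>x < y\<close>] r_nonneg by (intro mult_left_mono) auto
    ultimately show ?thesis
      by (metis mult_le_cancel_right_pos)
  qed
  ultimately show ?thesis by blast
qed

section \<open>Transitivity\<close>

lemma cross_le_trans:
  fixes r1 r2 r3 :: "'a::linorder \<Rightarrow> real"
  assumes nonneg: "\<And>x. 0 \<le> r1 x" "\<And>x. 0 \<le> r2 x" "\<And>x. 0 \<le> r3 x"
    and le12: "\<And>x y. x < y \<Longrightarrow> r2 x * r1 y \<le> r2 y * r1 x"
    and le23: "\<And>x y. x < y \<Longrightarrow> r3 x * r2 y \<le> r3 y * r2 x"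
    and "r2 z \<noteq> 0" and "x < y"
  shows "r3 x * r1 y \<le> r3 y * r1 x"
proof -
  have z: "0 < r2 z"
    using nonneg(2)[of z] assms(6) by simp
  \<comment> \<open>To the right of a point with \<open>r2 > 0\<close>, every zero of
    \<open>r2\<close> is a zero of \<open>r1\<close>; to the left of such a point, every zero of
    \<open>r2\<close> is a zero of \<open>r3\<close>.\<close>
  have r1_zero: "r1 v = 0" if "u < v" "0 < r2 u" "r2 v = 0" for u v
    using le12[OF that(1)] that nonneg(1)[of v] by (simp add: mult_le_0_iff)
  have r3_zero: "r3 u = 0" if "u < v" "0 < r2 v" "r2 u = 0" for u v
    using le23[OF that(1)] that nonneg(3)[of u] by (simp add: mult_le_0_iff)
  consider (pos) "0 < r2 x" "0 < r2 y" | (x) "0 < r2 x" "r2 y = 0" | (y) "r2 x = 0" "0 < r2 y"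
    | (zero) "r2 x = 0" "r2 y = 0"
    using nonneg(2)[of x] nonneg(2)[of y] by fastforce
  then show ?thesis
  proof cases
    case pos
    have "(r3 x * r2 y) * (r2 x * r1 y) \<le> (r3 y * r2 x) * (r2 y * r1 x)"
      using nonneg by (intro mult_mono[OF le23[OF \<open>x < y\<close>] le12[OF \<open>x < y\<close>]]) auto
    then have "(r3 x * r1 y) * (r2 x * r2 y) \<le> (r3 y * r1 x) * (r2 x * r2 y)"
      by (simp add: mult_ac)
    with pos show ?thesis
      by (metis mult_le_cancel_right_pos mult_pos_pos)
  next
    case x
    then show ?thesis using r1_zero \<open>x < y\<close> nonneg by simp
  next
    case y
    then show ?thesis using r3_zero \<open>x < y\<close> nonneg by simp
  next
    case zero
    then have "x \<noteq> z" using z by auto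
    \<comment> \<open>If \<open>z\<close> lies to the right of \<open>x\<close>, then
      \<open>r3 x = 0\<close>; otherwise \<open>z < x < y\<close> and
      \<open>r1 y = 0\<close>.\<close>
    then have "r1 y = 0 \<or> r3 x = 0"
      using r1_zero[of z y] r3_zero[of x z] z zero \<open>x < y\<close> by (cases "x < z") auto
    then show ?thesis using nonneg by auto
  qed
qed

lemma lr_le_trans:
  assumes "real_distribution Q1" "real_distribution Q2" "real_distribution Q3"
    and le12: "Q1 \<le>\<^sub>l\<^sub>r Q2" and le23: "Q2 \<le>\<^sub>l\<^sub>r Q3"
  shows "Q1 \<le>\<^sub>l\<^sub>r Q3"
proof -
  interpret Q1: real_distribution Q1 by fact
  interpret Q2: real_distribution Q2 by fact
  interpret Q3: real_distribution Q3 by fact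
  \<comment> \<open>Two rounds of pairwise domination: \<open>K\<close> handles \<open>Q1\<close>
    and \<open>Q2\<close>, then \<open>L\<close> handles \<open>K\<close> and
    \<open>Q3\<close>.\<close>
  obtain K where K: "finite_measure K" "sets K = sets borel"
      "absolutely_continuous K Q1" "absolutely_continuous K Q2"
    using ex_finite_measure_dominating[OF Q1.finite_measure_axioms Q2.finite_measure_axioms] by auto
  obtain L where L: "finite_measure L" "sets L = sets borel"
      "absolutely_continuous L K" "absolutely_continuous L Q3"
    using ex_finite_measure_dominating[OF K(1) Q3.finite_measure_axioms] K(2) by auto
  interpret L: finite_measure L by fact
  note [measurable_cong] = L(2)
  have ac: "absolutely_continuous L Q1" "absolutely_continuous L Q2"
    using K(3,4) L(3) by (auto simp: absolutely_continuous_def)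
  obtain r1 :: "real \<Rightarrow> real" where r1 [measurable]: "r1 \<in> borel_measurable borel"
      and r1_nonneg: "\<And>x. 0 \<le> r1 x" and Q1: "Q1 = density L r1"
    by (rule L.ex_real_density[OF ac(1) _ Q1.sigma_finite_measure_axioms])
       (simp_all add: L(2) measurable_cong_sets[OF L(2) refl])
  obtain r2 :: "real \<Rightarrow> real" where r2 [measurable]: "r2 \<in> borel_measurable borel"
      and r2_nonneg: "\<And>x. 0 \<le> r2 x" and Q2: "Q2 = density L r2"
    by (rule L.ex_real_density[OF ac(2) _ Q2.sigma_finite_measure_axioms])
       (simp_all add: L(2) measurable_cong_sets[OF L(2) refl])
  obtain r3 :: "real \<Rightarrow> real" where r3 [measurable]: "r3 \<in> borel_measurable borel"
      and r3_nonneg: "\<And>x. 0 \<le> r3 x" and Q3: "Q3 = density L r3"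
    by (rule L.ex_real_density[OF L(4) _ Q3.sigma_finite_measure_axioms])
       (simp_all add: L(2) measurable_cong_sets[OF L(2) refl])
  obtain P12 where P12: "AE x in L. P12 x"
      "\<And>x y. P12 x \<Longrightarrow> P12 y \<Longrightarrow> x < y \<Longrightarrow> r2 x * r1 y \<le> r2 y * r1 x"
    using lr_le_AE_cross_le[OF le12 L.sigma_finite_measure_axioms L(2) r1 r2 r1_nonneg r2_nonneg Q1 Q2]
    by blast
  obtain P23 where P23: "AE x in L. P23 x"
      "\<And>x y. P23 x \<Longrightarrow> P23 y \<Longrightarrow> x < y \<Longrightarrow> r3 x * r2 y \<le> r3 y * r2 x"
    using lr_le_AE_cross_le[OF le23 L.sigma_finite_measure_axioms L(2) r2 r3 r2_nonneg r3_nonneg Q2 Q3]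
    by blast
  have "AE x in L. P12 x \<and> P23 x"
    using P12(1) P23(1) by eventually_elim simp
  then obtain N where N: "{x \<in> space L. \<not> (P12 x \<and> P23 x)} \<subseteq> N" "N \<in> null_sets L"
    by (metis AE_E null_setsI)
  have [measurable]: "N \<in> sets borel"
    using N(2) L(2) by (auto simp: null_sets_def)
  have P: "P12 x" "P23 x" if "x \<notin> N" for x
    using N(1) that sets_eq_imp_space_eq[OF L(2)] by auto
  \<comment> \<open>Zeroing all densities on the exceptional null set \<open>N\<close> leaves the
    measures unchanged and turns the almost everywhere inequalities into everywhere ones.\<close>
  define s where "s r x = (if x \<in> N then 0 else r x)" for r :: "real \<Rightarrow> real" and x
  have s_meas [measurable]: "s r \<in> borel_measurable borel" if [measurable]: "r \<in> borel_measurable borel" for r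
    unfolding s_def by measurable
  have s_density: "density L r = density L (s r)" if [measurable]: "r \<in> borel_measurable borel"
    for r :: "real \<Rightarrow> real"
  proof (rule density_cong)
    show "AE x in L. ennreal (r x) = ennreal (s r x)"
      using AE_not_in[OF N(2)] by eventually_elim (simp add: s_def)
  qed auto
  \<comment> \<open>Otherwise \<open>Q2\<close> would have total mass 0 instead of 1.\<close>
  have "\<exists>z. s r2 z \<noteq> 0"
  proof (rule ccontr)
    assume "\<not> ?thesis"
    then have "emeasure Q2 (space Q2) = 0"
      unfolding Q2 s_density[OF r2] by (simp add: emeasure_density)
    then show False
      using Q2.emeasure_space_1 by simp
  qed
  then obtain z where z: "s r2 z \<noteq> 0" ..
  have "s r3 x * s r1 y \<le> s r3 y * s r1 x" if "x < y" for x y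
  proof (rule cross_le_trans[where ?r2.0 = "s r2", OF _ _ _ _ _ z that])
    \<comment> \<open>If \<open>x\<close> or \<open>y\<close> lies in \<open>N\<close>, both sides
      are 0.\<close>
    show "s r2 x * s r1 y \<le> s r2 y * s r1 x" if "x < y" for x y
      using P12(2)[OF _ _ that] P(1)[of x] P(1)[of y] by (auto simp: s_def)
    show "s r3 x * s r2 y \<le> s r3 y * s r2 x" if "x < y" for x y
      using P23(2)[OF _ _ that] P(2)[of x] P(2)[of y] by (auto simp: s_def)
  qed (auto simp: s_def r1_nonneg r2_nonneg r3_nonneg)
  then show ?thesis
    unfolding lr_le_iff
    using Q1 Q3 s_density[OF r1] s_density[OF r3] L(2) L.sigma_finite_measure_axioms
    by (intro exI[of _ L] exI[of _ "s r1"] exI[of _ "s r3"])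
       (auto simp: s_def[abs_def] r1_nonneg r3_nonneg)
qed

theorem lemma6:
  fixes Q1 Q2 Q3 :: "real measure"
  assumes "real_distribution Q1" and "real_distribution Q2" and "real_distribution Q3"
  shows "Q1 \<le>\<^sub>l\<^sub>r Q1 \<and>
    (Q1 \<le>\<^sub>l\<^sub>r Q2 \<and> Q2 \<le>\<^sub>l\<^sub>r Q1 \<longrightarrow> Q1 = Q2) \<and>
    (Q1 \<le>\<^sub>l\<^sub>r Q2 \<and> Q2 \<le>\<^sub>l\<^sub>r Q3 \<longrightarrow> Q1 \<le>\<^sub>l\<^sub>r Q3)"
  using assms lr_le_refl lr_le_antisym lr_le_trans by blast

end
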